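(* Let $q\ge0$ be a fixed integer. The number of Motzkin trees of size $n$ with exactly $q$ unary nodes is $0$ if $n\equiv q \pmod 2$; otherwise it is asymptotically equivalent to $$\sqrt{\frac{2}{\pi}}\;\frac{1}{2^q\,q!}\;2^n\,n^{q-\frac32},$$ as $n\to\infty$ (with $n\not\equiv q \pmod 2$).
   Context: A Motzkin tree is a finite plane rooted tree in which every node has 0, 1 or 2 children; nodes with exactly one child are called unary nodes. The size is the total number of nodes. *)

theory Defs
  imports "HOL-Analysis.Analysis" "HOL-Library.Landau_Symbols" "HOL-Number_Theory.Cong"
begin

datatype motzkin_tree =
    Leaf
  | Unary motzkin_tree
  | Binary motzkin_tree motzkin_tree

text \<open>
  The predefined \<open>size\<close> function of the datatype is 0 on leaves, hence the separate
  function counting all nodes, leaves included.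
\<close>

primrec nodes :: "motzkin_tree \<Rightarrow> nat" where
  "nodes Leaf = 1"
| "nodes (Unary t) = 1 + nodes t"
| "nodes (Binary l r) = 1 + nodes l + nodes r"

primrec unary_nodes :: "motzkin_tree \<Rightarrow> nat" where
  "unary_nodes Leaf = 0"
| "unary_nodes (Unary t) = 1 + unary_nodes t"
| "unary_nodes (Binary l r) = unary_nodes l + unary_nodes r"

definition motzkin_trees :: "nat \<Rightarrow> nat \<Rightarrow> motzkin_tree set" where
  "motzkin_trees n q = {t. nodes t = n \<and> unary_nodes t = q}"

definition motzkin_count :: "nat \<Rightarrow> nat \<Rightarrow> nat" where
  "motzkin_count n q = card (motzkin_trees n q)"

text \<open>
  \<open>card\<close> is 0 on infinite sets; finiteness of the classes makes it the actual count.
\<close>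

lemma finite_nodes_le: "finite {t. nodes t \<le> n}"
proof (induction n)
  case 0
  have "nodes t > 0" for t by (cases t) auto
  then have "{t. nodes t \<le> 0} = {}" by simp
  then show ?case by (metis finite.emptyI)
next
  case (Suc n)
  let ?S = "{t. nodes t \<le> n}"
  have "{t. nodes t \<le> Suc n} \<subseteq> {Leaf} \<union> Unary ` ?S \<union> (\<lambda>(l, r). Binary l r) ` (?S \<times> ?S)"
  proof
    fix t assume "t \<in> {t. nodes t \<le> Suc n}"
    then show "t \<in> {Leaf} \<union> Unary ` ?S \<union> (\<lambda>(l, r). Binary l r) ` (?S \<times> ?S)"
      by (cases t) auto
  qed
  moreover have "finite ({Leaf} \<union> Unary ` ?S \<union> (\<lambda>(l, r). Binary l r) ` (?S \<times> ?S))"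
    using Suc.IH by blast
  ultimately show ?case by (rule finite_subset)
qed

lemma finite_motzkin_trees: "finite (motzkin_trees n q)"
  by (rule finite_subset[OF _ finite_nodes_le[of n]]) (auto simp: motzkin_trees_def)

end

theory Submission
  imports Defs "HOL-Real_Asymp.Real_Asymp"
begin

text \<open>
  Let \<open>F\<^sub>k\<close> be the generating function, by number of unary nodes, of the trees with \<open>k\<close> binary
  nodes. Splitting at the root gives \<open>F\<^sub>k (1 - X) = [k = 0] + (\<Sum>i<k. F\<^sub>i F\<^bsub>k-1-i\<^esub>)\<close>, hence
  \<open>F\<^sub>k = c\<^sub>k / (1 - X)\<^bsup>2k+1\<^esup>\<close> where the \<open>c\<^sub>k\<close> are the Catalan numbers. So there are
  \<open>c\<^sub>k (2k+q choose q)\<close> trees with \<open>k\<close> binary and \<open>q\<close> unary nodes, and their size is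
  \<open>n = 2k+q+1\<close>. The factor \<open>c\<^sub>k\<close> is asymptotically \<open>4\<^sup>k / (sqrt pi k\<^bsup>3/2\<^esup>)\<close> because
  \<open>Gamma (1/2) = sqrt pi\<close>, and the binomial coefficient is asymptotically \<open>(2k)\<^sup>q / q!\<close>.
\<close>

unbundle no vec_syntax
unbundle fps_syntax

section \<open>Decomposition at the root\<close>

primrec binary_nodes :: "motzkin_tree \<Rightarrow> nat" where
  "binary_nodes Leaf = 0"
| "binary_nodes (Unary t) = binary_nodes t"
| "binary_nodes (Binary l r) = 1 + binary_nodes l + binary_nodes r"

text \<open>Each binary node adds one leaf, so a tree has \<open>binary_nodes t + 1\<close>
  leaves.\<close>

lemma nodes_eq: "nodes t = 2 * binary_nodes t + unary_nodes t + 1"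
  by (induction t) auto

definition trees :: "nat \<Rightarrow> nat \<Rightarrow> motzkin_tree set" where
  "trees k q = {t. binary_nodes t = k \<and> unary_nodes t = q}"

lemma motzkin_trees_eq_trees: "motzkin_trees (2 * k + q + 1) q = trees k q"
  by (auto simp: motzkin_trees_def trees_def nodes_eq)

lemma finite_trees [simp]: "finite (trees k q)"
  using finite_motzkin_trees motzkin_trees_eq_trees by metis

lemma motzkin_count_same_parity: "[n = q] (mod 2) \<Longrightarrow> motzkin_count n q = 0"
proof -
  assume "[n = q] (mod 2)"
  then have "motzkin_trees n q = {}"
    by (auto simp: motzkin_trees_def nodes_eq cong_def) presburger
  then show ?thesis by (simp add: motzkin_count_def)
qed

lemma trees_unfold:
  "trees k q = {t. t = Leaf \<and> k = 0 \<and> q = 0} \<union> (if q = 0 then {} else Unary ` trees k (q - 1)) \<union>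
     (\<Union>i<k. \<Union>j\<le>q. (\<lambda>(l, r). Binary l r) ` (trees i j \<times> trees (k - 1 - i) (q - j)))"
  (is "_ = ?R")
proof (intro set_eqI iffI)
  fix t assume "t \<in> trees k q"
  then show "t \<in> ?R"
    by (cases t) (force simp: trees_def)+
next
  fix t assume "t \<in> ?R"
  then show "t \<in> trees k q"
    by (auto simp: trees_def split: if_splits)
qed

lemma card_trees:
  "card (trees k q) = (if k = 0 \<and> q = 0 then 1 else 0) + (if q = 0 then 0 else card (trees k (q - 1))) +
     (\<Sum>i<k. \<Sum>j\<le>q. card (trees i j) * card (trees (k - 1 - i) (q - j)))"
proof -
  let ?A = "{t. t = Leaf \<and> k = 0 \<and> q = 0}"
  let ?B = "if q = 0 then {} else Unary ` trees k (q - 1)"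
  let ?P = "\<lambda>i j. (\<lambda>(l, r). Binary l r) ` (trees i j \<times> trees (k - 1 - i) (q - j))"
  have P: "card (?P i j) = card (trees i j) * card (trees (k - 1 - i) (q - j))" for i j
    by (subst card_image) (auto simp: inj_on_def card_cartesian_product)
  \<comment> \<open>The left subtree determines both indices: \<open>j\<close> is its number of
    unary nodes and \<open>i\<close> its number of binary nodes.\<close>
  have disj_j: "?P i j \<inter> ?P i j' = {}" if "j \<noteq> j'" for i j j'
    using that by (auto simp: trees_def)
  have disj_i: "(\<Union>j\<le>q. ?P i j) \<inter> (\<Union>j\<le>q. ?P i' j) = {}" if "i \<noteq> i'" for i i'
    using that by (auto simp: trees_def)
  have C: "card (\<Union>i<k. \<Union>j\<le>q. ?P i j) = (\<Sum>i<k. \<Sum>j\<le>q. card (?P i j))"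
    by (subst card_UN_disjoint, simp, simp, use disj_i in blast)
       (intro sum.cong refl card_UN_disjoint; use disj_j in simp)
  have "card (trees k q) = card ?A + card ?B + card (\<Union>i<k. \<Union>j\<le>q. ?P i j)"
    by (subst trees_unfold, subst card_Un_disjoint, simp, simp, force, subst card_Un_disjoint) auto
  moreover have "card ?A = (if k = 0 \<and> q = 0 then 1 else 0)" by auto
  moreover have "card ?B = (if q = 0 then 0 else card (trees k (q - 1)))"
    by (auto simp: card_image inj_on_def)
  ultimately show ?thesis by (simp only: C P)
qed

section \<open>Generating functions by unary nodes\<close>

definition trees_fps :: "nat \<Rightarrow> real fps" where
  "trees_fps k = Abs_fps (\<lambda>q. real (card (trees k q)))"

lemma trees_fps_rec:
  "trees_fps k * (1 - fps_X) = (if k = 0 then 1 else 0) + (\<Sum>i<k. trees_fps i * trees_fps (k - 1 - i))"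
proof (rule fps_ext)
  fix q
  have "trees_fps k $ q = (if k = 0 \<and> q = 0 then 1 else 0) + (if q = 0 then 0 else trees_fps k $ (q - 1)) +
     (\<Sum>i<k. \<Sum>j\<le>q. trees_fps i $ j * trees_fps (k - 1 - i) $ (q - j))"
    unfolding trees_fps_def fps_nth_Abs_fps by (subst card_trees) simp
  then show "(trees_fps k * (1 - fps_X)) $ q
    = ((if k = 0 then 1 else 0) + (\<Sum>i<k. trees_fps i * trees_fps (k - 1 - i))) $ q"
    by (simp add: fps_sum_nth fps_mult_nth[of "trees_fps _" "trees_fps _"] ring_distribs atMost_atLeast0)
qed

text \<open>In the induction every product in the recurrence carries the same power of
  \<open>G\<close>, since \<open>(2i+1) + (2(k-1-i)+1) = 2k\<close>. The power therefore leaves the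
  sum, and division by \<open>1 - fps_X\<close> supplies the last factor.\<close>

lemma trees_fps_eq:
  "trees_fps k = fps_const (real (card (trees k 0))) * inverse ((1 - fps_X) ^ (2 * k + 1))"
proof (induction k rule: less_induct)
  case (less k)
  define G :: "real fps" where "G = inverse (1 - fps_X)"
  have G: "(1 - fps_X) * G = 1"
    unfolding G_def by (simp add: inverse_mult_eq_1')
  have inv: "inverse ((1 - fps_X) ^ m) = G ^ m" for m
    by (simp add: G_def fps_inverse_power)
  define c where "c = (\<lambda>k. real (card (trees k 0)))"
  \<comment> \<open>The case without unary nodes: the constants obey the Catalan recurrence.\<close>
  have c: "c k = (if k = 0 then 1 else 0) + (\<Sum>i<k. c i * c (k - 1 - i))"
    unfolding c_def by (subst card_trees) simp
  have "trees_fps k = trees_fps k * (1 - fps_X) * G"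
    by (simp add: G mult.assoc)
  also have "\<dots> = ((if k = 0 then 1 else 0) + (\<Sum>i<k. trees_fps i * trees_fps (k - 1 - i))) * G"
    by (simp add: trees_fps_rec)
  also have "(\<Sum>i<k. trees_fps i * trees_fps (k - 1 - i)) = (\<Sum>i<k. fps_const (c i * c (k - 1 - i)) * G ^ (2 * k))"
  proof (rule sum.cong)
    fix i assume "i \<in> {..<k}"
    then have i: "i < k" "k - 1 - i < k" by auto
    have e: "(2 * i + 1) + (2 * (k - 1 - i) + 1) = 2 * k" using i by simp
    have "trees_fps i * trees_fps (k - 1 - i)
      = fps_const (c i) * fps_const (c (k - 1 - i)) * (G ^ (2 * i + 1) * G ^ (2 * (k - 1 - i) + 1))"
      unfolding less.IH[OF i(1)] less.IH[OF i(2)] inv c_def by (simp only: mult_ac)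
    then show "trees_fps i * trees_fps (k - 1 - i) = fps_const (c i * c (k - 1 - i)) * G ^ (2 * k)"
      by (simp only: e flip: power_add fps_const_mult)
  qed simp
  also have "\<dots> = fps_const (\<Sum>i<k. c i * c (k - 1 - i)) * G ^ (2 * k)"
    by (rule fps_ext) (simp add: fps_sum_nth sum_distrib_right)
  \<comment> \<open>For \<open>k = 0\<close> the power of \<open>G\<close> is 1, so the extra
    summand fits the same form.\<close>
  also have "(if k = 0 then 1 else 0) + \<dots> = fps_const (c k) * G ^ (2 * k)"
    by (subst c) auto
  finally show ?case unfolding inv c_def by (simp add: mult_ac)
qed

text \<open>Combinatorially, \<open>q\<close> unary nodes are distributed over chains above the
  \<open>2k+1\<close> nodes of a full binary tree.\<close>

lemma card_trees_eq: "card (trees k q) = card (trees k 0) * ((2 * k + q) choose q)"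
proof -
  have "real (card (trees k q)) = trees_fps k $ q" by (simp add: trees_fps_def)
  also have "\<dots> = real (card (trees k 0)) * real ((2 * k + q) choose q)"
    using one_minus_const_fps_X_neg_power'[of "2 * k + 1" "1 :: real"]
    by (subst trees_fps_eq) simp
  finally show ?thesis by (simp flip: of_nat_mult)
qed

section \<open>Closed form for full binary trees\<close>

text \<open>
  The generating function \<open>C = 1 + X C\<^sup>2\<close> satisfies \<open>(1 - 2 X C)\<^sup>2 = 1 - 4 X\<close>; differentiating
  \<open>S = 1 - 2 X C\<close> yields \<open>(1 - 4 X) S' = - 2 S\<close>, whose coefficients give the recurrence.
\<close>

lemma catalan_recurrence:
  fixes c :: "nat \<Rightarrow> real"
  assumes 0: "c 0 = 1" and Suc: "\<And>k. c (Suc k) = (\<Sum>i\<le>k. c i * c (k - i))"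
  shows "(real k + 2) * c (Suc k) = (4 * real k + 2) * c k"
proof -
  define C where "C = Abs_fps c"
  define S where "S = 1 - 2 * fps_X * C"
  have C: "C = 1 + fps_X * C\<^sup>2"
  proof (rule fps_ext)
    fix n show "C $ n = (1 + fps_X * C\<^sup>2) $ n"
      by (cases n) (auto simp: C_def fps_square_nth 0 Suc)
  qed
  have S2: "S\<^sup>2 = 1 - 4 * fps_X"
  proof -
    have "S\<^sup>2 = 1 - 4 * fps_X * (C - fps_X * C\<^sup>2)"
      by (simp add: S_def power2_eq_square algebra_simps)
    also have "C - fps_X * C\<^sup>2 = 1" by (subst C) simp
    finally show ?thesis by simp
  qed
  have "fps_deriv (S\<^sup>2) = - 4" by (simp add: S2)
  then have "2 * (S * fps_deriv S) = 2 * (- 2)"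
    by (simp add: power2_eq_square algebra_simps)
  then have "S * fps_deriv S = - 2" by (subst (asm) mult_cancel_left) simp
  \<comment> \<open>Multiplying by \<open>S\<close> makes the equation linear in \<open>S\<close>,
    because the square of \<open>S\<close> is a polynomial.\<close>
  then have "S\<^sup>2 * fps_deriv S = - 2 * S" by (simp add: power2_eq_square mult.assoc)
  then have "((1 - 4 * fps_X) * fps_deriv S) $ Suc k = (- 2 * S) $ Suc k" by (simp add: S2)
  moreover have "S $ Suc n = - 2 * c n" for n
    by (simp add: S_def C_def mult.assoc numeral_fps_const)
  ultimately show ?thesis
    by (simp add: numeral_fps_const ring_distribs mult.assoc)
qed

lemma card_full_binary_trees:
  "real (card (trees k 0)) = fact (2 * k) / (fact k * fact (k + 1))"
proof (induction k)
  case 0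
  show ?case by (subst card_trees) simp
next
  case (Suc k)
  have "(real k + 2) * real (card (trees (Suc k) 0)) = (4 * real k + 2) * real (card (trees k 0))"
  proof (rule catalan_recurrence)
    show "real (card (trees 0 0)) = 1" by (subst card_trees) simp
    show "real (card (trees (Suc k) 0)) = (\<Sum>i\<le>k. real (card (trees i 0)) * real (card (trees (k - i) 0)))" for k
      by (subst card_trees) (simp add: lessThan_Suc_atMost)
  qed
  then have "real (card (trees (Suc k) 0)) = (4 * real k + 2) / (real k + 2) * real (card (trees k 0))"
    by (simp add: field_simps)
  also have "\<dots> = (4 * real k + 2) / (real k + 2) * (fact (2 * k) / (fact k * fact (k + 1)))"
    by (simp only: Suc.IH)
  \<comment> \<open>The fraction is expanded by \<open>k + 1\<close> to complete the
    factorials.\<close>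
  also have "\<dots> = (2 * real k + 2) * (2 * real k + 1) * fact (2 * k) / (((real k + 1) * fact k) * ((real k + 2) * fact (k + 1)))"
    by (simp add: divide_simps) (simp add: algebra_simps)
  also have "\<dots> = fact (2 * Suc k) / (fact (Suc k) * fact (Suc k + 1))"
    by (simp add: algebra_simps)
  finally show ?case .
qed

section \<open>Asymptotics\<close>

lemma card_full_binary_trees_asymp:
  "(\<lambda>k. real (card (trees k 0))) \<sim>[at_top] (\<lambda>k. 4 ^ k / (sqrt pi * real k powr (3 / 2)))"
proof (rule asymp_equivI')
  let ?G = "Gamma_series' (1 / 2 :: real)"
  \<comment> \<open>For \<open>k > 0\<close> this is exactly the quotient in question, as
    \<open>(2k)! / k!\<close> is \<open>4 ^ k\<close> times the Pochhammer symbol of 1/2 that is the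
    denominator of \<open>?G k\<close>.\<close>
  have "(\<lambda>k. sqrt pi / ?G k * (real k / real (k + 1))) \<longlonglongrightarrow> sqrt pi / Gamma (1 / 2) * 1"
  proof (intro tendsto_intros Gamma_series'_LIMSEQ)
    show "(\<lambda>k. real k / real (k + 1)) \<longlonglongrightarrow> 1" by real_asymp
  qed (simp add: Gamma_one_half_real)
  then have lim: "(\<lambda>k. sqrt pi / ?G k * (real k / real (k + 1))) \<longlonglongrightarrow> 1"
    by (simp add: Gamma_one_half_real)
  show "(\<lambda>k. real (card (trees k 0)) / (4 ^ k / (sqrt pi * real k powr (3 / 2)))) \<longlonglongrightarrow> 1"
  proof (rule Lim_transform_eventually[OF lim])
    show "\<forall>\<^sub>F k in sequentially. sqrt pi / ?G k * (real k / real (k + 1)) =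
        real (card (trees k 0)) / (4 ^ k / (sqrt pi * real k powr (3 / 2)))"
      using eventually_gt_at_top[of 0]
    proof eventually_elim
      case (elim k)
      \<comment> \<open>\<open>Gamma_series'\<close> contains the factorial of \<open>k - 1\<close>,
        here \<open>fact m\<close>.\<close>
      then obtain m where k: "k = Suc m" using gr0_conv_Suc by auto
      define P where "P = pochhammer (1 / 2 :: real) k"
      have P: "P > 0" unfolding P_def by (rule pochhammer_pos) simp
      have e: "exp (1 / 2 * ln (real k)) = sqrt (real k)"
        using elim by (simp add: powr_half_sqrt[symmetric] powr_def)
      have G: "?G k = fact m * sqrt (real k) / P"
        using e by (simp add: Gamma_series'_def P_def k)
      have pw: "real k powr (3 / 2) = real k * sqrt (real k)"
        using elim powr_add[of "real k" 1 "1 / 2"] by (simp add: powr_half_sqrt)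
      have "real (card (trees k 0)) = 4 ^ k * P / fact (k + 1)"
        by (simp add: card_full_binary_trees fact_double P_def power_mult)
      also have "fact (k + 1) = real (k + 1) * (real k * fact m)"
        by (simp add: k)
      finally show ?case
        using elim P by (simp only: G pw) (simp add: divide_simps del: of_nat_add of_nat_Suc)
    qed
  qed
qed

lemma binomial_add_asymp:
  fixes q :: nat
  shows "(\<lambda>n. real ((n + q) choose q)) \<sim>[at_top] (\<lambda>n. real n ^ q / fact q)"
proof (rule asymp_equivI')
  have "(n + q) choose q = (q + n) choose n" for n
    using binomial_symmetric[of q "n + q"] by (simp add: add.commute)
  then show "(\<lambda>n. real ((n + q) choose q) / (real n ^ q / fact q)) \<longlonglongrightarrow> 1"
    using binomial_asymptotic'[of q, where ?'a = real] by simp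
qed

lemma card_trees_asymp:
  "(\<lambda>k. real (card (trees k q))) \<sim>[at_top]
    (\<lambda>k. sqrt (2 / pi) * (1 / (2 ^ q * fact q)) * 2 ^ (2 * k + q + 1) *
      real (2 * k + q + 1) powr (real q - 3 / 2))"
proof -
  let ?n = "\<lambda>k. real (2 * k + q + 1)"
  have h: "filterlim (\<lambda>k :: nat. 2 * k) at_top at_top" by real_asymp
  have n: "?n \<sim>[at_top] (\<lambda>k. 2 * real k)" by real_asymp
  have eq: "real (card (trees k q)) = real (card (trees k 0)) * real ((2 * k + q) choose q)" for k
    by (simp add: card_trees_eq[of _ q])
  have "(\<lambda>k. real (card (trees k q))) \<sim>[at_top]
      (\<lambda>k. 4 ^ k / (sqrt pi * real k powr (3 / 2)) * (real (2 * k) ^ q / fact q))"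
    unfolding eq
    by (intro asymp_equiv_mult card_full_binary_trees_asymp
          asymp_equiv_compose'[OF binomial_add_asymp h])
  also have "\<dots> \<sim>[at_top] (\<lambda>k. sqrt (2 / pi) * (1 / (2 ^ q * fact q)) * 2 ^ (2 * k + q + 1) *
      (2 * real k) powr (real q - 3 / 2))"
  proof (rule asymp_equiv_refl_ev)
    show "\<forall>\<^sub>F k in sequentially. 4 ^ k / (sqrt pi * real k powr (3 / 2)) * (real (2 * k) ^ q / fact q) =
       sqrt (2 / pi) * (1 / (2 ^ q * fact q)) * 2 ^ (2 * k + q + 1) * (2 * real k) powr (real q - 3 / 2)"
      using eventually_gt_at_top[of 0]
    proof eventually_elim
      case (elim k)
      have "(2 :: real) powr (3 / 2) = 2 * sqrt 2"
        using powr_add[of "2 :: real" 1 "1 / 2"] by (simp add: powr_half_sqrt)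
      then have pw: "(2 * real k) powr (real q - 3 / 2) = (2 * real k) ^ q / (2 * sqrt 2 * real k powr (3 / 2))"
        using elim by (simp add: powr_diff powr_realpow powr_mult)
      have "(2 :: real) ^ (2 * k + q + 1) = 2 * 2 ^ q * 4 ^ k"
        by (simp add: power_add power_mult)
      then show ?case
        unfolding pw using elim by (simp add: real_sqrt_divide field_simps)
    qed
  qed
  \<comment> \<open>Only the base of the power with fixed exponent is replaced by an equivalent one;
    equivalence does not survive exponentiation, so \<open>2 ^ (2 * k + q + 1)\<close> is kept
    exact.\<close>
  also have "\<dots> \<sim>[at_top] (\<lambda>k. sqrt (2 / pi) * (1 / (2 ^ q * fact q)) * 2 ^ (2 * k + q + 1) *
      ?n k powr (real q - 3 / 2))"
    by (intro asymp_equiv_mult asymp_equiv_refl asymp_equiv_powr_real asymp_equiv_symI[OF n]) auto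
  finally show ?thesis .
qed

theorem proposition1:
  fixes q :: nat
  shows "(\<forall>n. [n = q] (mod 2) \<longrightarrow> motzkin_count n q = 0) \<and>
    (\<lambda>n. real (motzkin_count n q))
      \<sim>[inf at_top (principal {n. \<not> [n = q] (mod 2)})]
    (\<lambda>n. sqrt (2 / pi) * (1 / (2 ^ q * fact q)) * 2 ^ n * real n powr (real q - 3 / 2))"
proof (intro conjI allI impI motzkin_count_same_parity)
  let ?F = "inf at_top (principal {n. \<not> [n = q] (mod 2)})"
  let ?f = "\<lambda>n. sqrt (2 / pi) * (1 / (2 ^ q * fact q)) * 2 ^ n * real n powr (real q - 3 / 2)"
  \<comment> \<open>This recovers the number of binary nodes from the size. Truncated subtraction is
    harmless once \<open>n > q\<close>, and on \<open>?F\<close> the parity makes the division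
    exact.\<close>
  let ?h = "\<lambda>n. (n - q - 1) div 2"
  have "filterlim ?h at_top at_top" by real_asymp
  then have h: "filterlim ?h at_top ?F"
    by (rule filterlim_mono) auto
  have n: "\<forall>\<^sub>F n in ?F. n = 2 * ?h n + q + 1"
    unfolding eventually_inf_principal
    using eventually_gt_at_top[of q]
    by eventually_elim (simp add: cong_def, presburger)
  show "(\<lambda>n. real (motzkin_count n q)) \<sim>[?F] ?f"
  proof (rule iffD1[OF asymp_equiv_cong asymp_equiv_compose'[OF card_trees_asymp h]])
    show "\<forall>\<^sub>F n in ?F. real (card (trees (?h n) q)) = real (motzkin_count n q)"
      using n by eventually_elim (metis motzkin_count_def motzkin_trees_eq_trees)
    show "\<forall>\<^sub>F n in ?F. sqrt (2 / pi) * (1 / (2 ^ q * fact q)) * 2 ^ (2 * ?h n + q + 1) *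
        real (2 * ?h n + q + 1) powr (real q - 3 / 2) = ?f n"
      using n by eventually_elim metis
  qed
qed

end
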